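(* Let $\kappa<0$, $0<\alpha<1$, $T>0$, let $N\ge 2$ be an integer, $\tau=T/N$ and $t_n=n\tau$. Let $u$ be the solution of $u'(t)=\kappa u(t)+f(t)$, $0<t\le T$, $u(0)=u_0$, and suppose that $u$ satisfies the regularity bound $|u^{(k)}(t)|\le M\,t^{\alpha-k}$ for $k=1,2,3$ and $0<t\le T$, with some constant $M$. Let $U^n$ be given by the BDF2 scheme, started by one implicit Euler step, $$\frac{U^1-U^0}{\tau}=\kappa U^1+f(t_1),\qquad \frac{3U^n-4U^{n-1}+U^{n-2}}{2\tau}=\kappa U^n+f(t_n),\quad 2\le n\le N,\qquad U^0=u_0,$$ and let $e^n=u(t_n)-U^n$. Then there is a constant $C_{u,\alpha}>0$ depending only on $\alpha$ and $M$ such that, whenever $0<-4\kappa\tau<1$, for all $2\le n\le N$, $$|e^n|\le e^{\kappa t_n/2}|e^{0}|+2C_{u,\alpha}\Big(C_5e^{\kappa t_n/2}\tau^\alpha+C_6\,t_{n-1}^{\alpha-2}\tau^2\Big),$$ where $C_5:=\frac{2}{2-\alpha}+4e^{\kappa t_n/4}$ and $$C_6:=\begin{cases}\frac{1}{2-\alpha}\big(2^{2-\alpha}(1-e^{\kappa t_n/2})-1\big), & t_n>\frac{2}{\kappa}\ln(1-2^{\alpha-2}),\\ 0,& t_n\le \frac{2}{\kappa}\ln(1-2^{\alpha-2}).\end{cases}$$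
   Context: The solution $u$ is real-valued, continuous on $[0,T]$ and three times continuously differentiable on $(0,T]$, with a possible weak singularity at $t=0$; $f$ is the corresponding given source term on $(0,T]$. The constant $C_{u,\alpha}$ is independent of $n$, $N$, $\tau$, $T$ and $\kappa$. *)

theory Defs
  imports "HOL-Analysis.Analysis"
begin

text \<open>
  Iterated derivatives relative to a set: on an interval the derivative is one-sided
  at an end point belonging to it, such as \<open>T\<close> in \<open>{0<..T}\<close>.
\<close>

primrec nth_deriv_within :: "nat \<Rightarrow> (real \<Rightarrow> real) \<Rightarrow> real set \<Rightarrow> real \<Rightarrow> real" where
  "nth_deriv_within 0 u S = u"
| "nth_deriv_within (Suc k) u S = (\<lambda>t. vector_derivative (nth_deriv_within k u S) (at t within S))"

definition times_cont_diff_on :: "nat \<Rightarrow> (real \<Rightarrow> real) \<Rightarrow> real set \<Rightarrow> bool" where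
  "times_cont_diff_on k u S \<longleftrightarrow>
     (\<forall>j<k. nth_deriv_within j u S differentiable_on S) \<and>
     (\<forall>j\<le>k. continuous_on S (nth_deriv_within j u S))"

definition ivp_solution ::
  "real \<Rightarrow> (real \<Rightarrow> real) \<Rightarrow> real \<Rightarrow> real \<Rightarrow> (real \<Rightarrow> real) \<Rightarrow> bool" where
  "ivp_solution \<kappa> f u0 T u \<longleftrightarrow>
     continuous_on {0..T} u \<and> times_cont_diff_on 3 u {0<..T} \<and>
     u 0 = u0 \<and>
     (\<forall>t\<in>{0<..T}. nth_deriv_within 1 u {0<..T} t = \<kappa> * u t + f t)"

definition regularity_bound :: "real \<Rightarrow> real \<Rightarrow> real \<Rightarrow> (real \<Rightarrow> real) \<Rightarrow> bool" where
  "regularity_bound \<alpha> M T u \<longleftrightarrow>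
     (\<forall>k\<in>{1..3}. \<forall>t\<in>{0<..T}.
        \<bar>nth_deriv_within k u {0<..T} t\<bar> \<le> M * t powr (\<alpha> - real k))"

text \<open>The values \<open>U n\<close> for \<open>n > N\<close> are unconstrained.\<close>

definition bdf2_scheme ::
  "real \<Rightarrow> (real \<Rightarrow> real) \<Rightarrow> real \<Rightarrow> real \<Rightarrow> nat \<Rightarrow> (nat \<Rightarrow> real) \<Rightarrow> bool" where
  "bdf2_scheme \<kappa> f u0 \<tau> N U \<longleftrightarrow>
     U 0 = u0 \<and>
     (U 1 - U 0) / \<tau> = \<kappa> * U 1 + f \<tau> \<and>
     (\<forall>n\<in>{2..N}. (3 * U n - 4 * U (n - 1) + U (n - 2)) / (2 * \<tau>)
        = \<kappa> * U n + f (real n * \<tau>))"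

text \<open>In the two constants below, \<open>t\<close> stands for \<open>t\<^sub>n\<close>.\<close>

definition C5 :: "real \<Rightarrow> real \<Rightarrow> real \<Rightarrow> real" where
  "C5 \<alpha> \<kappa> t = 2 / (2 - \<alpha>) + 4 * exp (\<kappa> * t / 4)"

definition C6 :: "real \<Rightarrow> real \<Rightarrow> real \<Rightarrow> real" where
  "C6 \<alpha> \<kappa> t =
     (if t > 2 / \<kappa> * ln (1 - 2 powr (\<alpha> - 2))
      then 1 / (2 - \<alpha>) * (2 powr (2 - \<alpha>) * (1 - exp (\<kappa> * t / 2)) - 1)
      else 0)"

end

theory Submission
  imports Defs
begin

text \<open>
  For \<open>0 < -\<kappa> * \<tau> < 1/4\<close> the characteristic polynomial of the scheme has two real roots, one at
  most \<open>exp (\<kappa> * \<tau>)\<close> and one at most \<open>1/2\<close>. Hence the error at step \<open>n\<close> is bounded by the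
  consistency errors of the steps \<open>j \<le> n\<close>, which are of size \<open>\<tau> powr \<alpha> * j powr (\<alpha> - 3)\<close>, damped
  by \<open>exp (\<kappa> * (n - j) * \<tau>)\<close>. Splitting this sum at \<open>j = n/2\<close> gives the bound
  \<open>exp (\<kappa> * t\<^sub>n / 2) * \<tau> powr \<alpha> + t\<^sub>n powr (\<alpha> - 2) * \<tau>\<^sup>2\<close> up to a constant.
\<close>

section \<open>Stability of the two-step recurrence\<close>

text \<open>The left side is the larger root of \<open>(3 + 2*l) * r^2 - 4 * r + 1\<close>. Both
  sides are compared through Taylor polynomials at 0: the square root lies below
  \<open>1 - l - l^2/2\<close>, the exponential above its cubic polynomial, and after multiplication
  by \<open>3 + 2*l\<close> the two agree up to a nonnegative term of order
  \<open>l^3\<close>.\<close>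

lemma bdf2_principal_root_le_exp:
  fixes l :: real
  assumes "0 \<le> l" "l \<le> 1/4"
  shows "(2 + sqrt (1 - 2*l)) / (3 + 2*l) \<le> exp (-l)"
proof -
  obtain x where x: "exp (-l) = (\<Sum>m<4. (-l)^m / fact m) + exp x / fact 4 * (-l)^4"
    using Maclaurin_exp_le[of "-l" 4] by auto
  have "exp (-l) \<ge> 1 - l + l^2/2 - l^3/6"
  proof -
    have "(\<Sum>m<4. (-l)^m / fact m) = 1 - l + l^2/2 - l^3/6"
      by (simp add: numeral_eq_Suc)
    moreover have "exp x / fact 4 * (-l)^4 \<ge> 0" by simp
    ultimately show ?thesis using x by linarith
  qed
  then have e: "(3 + 2*l) * exp (-l) \<ge> (3 + 2*l) * (1 - l + l^2/2 - l^3/6)"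
    using assms by (intro mult_left_mono) auto
  have "l * l \<le> (1/4) * (1/4)"
    using assms by (intro mult_mono) auto
  then have pos: "1 - l - l^2/2 \<ge> 0"
    using assms by (simp add: power2_eq_square)
  have "sqrt (1 - 2*l) \<le> 1 - l - l^2/2"
  proof (rule real_le_lsqrt[OF pos])
    have "(1 - l - l^2/2)^2 = 1 - 2*l + l^3 + l^4/4"
      by (simp add: power2_eq_square power3_eq_cube power4_eq_xxxx algebra_simps)
    then show "1 - 2*l \<le> (1 - l - l^2/2)^2" using assms by simp
  qed
  moreover have "(3 + 2*l) * (1 - l + l^2/2 - l^3/6) = 3 - l - l^2/2 + l^3 * (1/2 - l/3)"
    by (simp add: power2_eq_square power3_eq_cube field_simps)
  moreover have "l^3 * (1/2 - l/3) \<ge> 0" using assms by simp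
  ultimately have "2 + sqrt (1 - 2*l) \<le> (3 + 2*l) * exp (-l)"
    using e by linarith
  then show ?thesis using assms by (simp add: divide_simps mult.commute)
qed

text \<open>With the roots \<open>r1\<close>, \<open>r2\<close> the recurrence factors: the
  differences \<open>e n - r2 * e (n-1)\<close> obey a first-order recurrence with factor
  \<open>r1\<close>, at most \<open>exp (-l)\<close>. Undoing the difference is a second first-order
  recurrence with factor \<open>r2\<close>, at most 1/2, which costs only a constant.\<close>

lemma bdf2_stability:
  fixes l :: real and e h :: "nat \<Rightarrow> real"
  assumes l: "0 < l" "l < 1/4"
    and e0: "e 0 = 0" and e1: "(1 + l) * e 1 = h 1"
    and rec: "\<And>n. 2 \<le> n \<Longrightarrow> n \<le> N \<Longrightarrow> (3 + 2*l) * e n - 4 * e (n-1) + e (n-2) = h n"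
    and n: "1 \<le> n" "n \<le> N"
  shows "\<bar>e n\<bar> \<le> 3 * (\<Sum>j=1..n. exp (-l) ^ (n-j) * \<bar>h j\<bar>)"
proof -
  define s where "s = sqrt (1 - 2*l)"
  define r1 where "r1 = (2 + s) / (3 + 2*l)"
  define r2 where "r2 = (2 - s) / (3 + 2*l)"
  define \<rho> where "\<rho> = exp (-l)"
  define S where "S n = (\<Sum>j=1..n. \<rho> ^ (n-j) * \<bar>h j\<bar>)" for n
  have s2: "s^2 = 1 - 2*l" using l by (simp add: s_def)
  have s0: "0 \<le> s" "s \<le> 1" using l by (auto simp: s_def)
  \<comment> \<open>A number in [0,1] dominates its square; the resulting lower bound on
    \<open>s\<close> gives \<open>r2 \<le> 1/2\<close>.\<close>
  have "s * s \<le> 1 * s" using s0 by (intro mult_right_mono) auto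
  then have "s \<ge> 1 - 2*l" using s2 by (simp add: power2_eq_square)
  then have r2: "0 \<le> r2" "r2 \<le> 1/2" using l s0 by (auto simp: r2_def field_simps)
  have r1: "0 \<le> r1" "r1 \<le> \<rho>"
    using l s0 bdf2_principal_root_le_exp[of l] by (auto simp: r1_def \<rho>_def s_def)
  have \<rho>: "\<rho> \<ge> 3/4" using exp_ge_add_one_self[of "-l"] l unfolding \<rho>_def by linarith
  have S_Suc: "S (Suc n) = \<rho> * S n + \<bar>h (Suc n)\<bar>" for n
  proof -
    have "(\<Sum>j=1..n. \<rho> ^ (Suc n - j) * \<bar>h j\<bar>) = (\<Sum>j=1..n. \<rho> * (\<rho> ^ (n - j) * \<bar>h j\<bar>))"
      by (intro sum.cong) (auto simp: Suc_diff_le)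
    then show ?thesis by (simp add: S_def sum_distrib_left)
  qed
  have S_nonneg: "S n \<ge> 0" for n using \<rho> by (auto simp: S_def intro!: sum_nonneg)
  have sumr: "r1 + r2 = 4 / (3 + 2*l)"
    by (simp add: r1_def r2_def add_divide_distrib[symmetric])
  have prodr: "r1 * r2 = 1 / (3 + 2*l)"
  proof -
    have "(2 + s) * (2 - s) = 3 + 2*l" using s2 by (simp add: power2_eq_square algebra_simps)
    then show ?thesis using l by (simp add: r1_def r2_def)
  qed
  have *: "\<bar>e (Suc n) - r2 * e n\<bar> \<le> S (Suc n) \<and> \<bar>e (Suc n)\<bar> \<le> 3 * S (Suc n)" if "Suc n \<le> N" for n
    using that
  proof (induction n)
    case 0
    have "\<bar>e 1\<bar> * 1 \<le> \<bar>e 1\<bar> * (1 + l)" using l by (intro mult_left_mono) auto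
    also have "\<dots> = \<bar>h 1\<bar>" using e1[symmetric] l by (simp add: abs_mult)
    finally have "\<bar>e 1\<bar> \<le> \<bar>h 1\<bar>" by simp
    moreover have "S 1 = \<bar>h 1\<bar>" by (simp add: S_def)
    ultimately show ?case using e0 by simp
  next
    case (Suc n)
    define m where "m = Suc n"
    have IH: "\<bar>e m - r2 * e n\<bar> \<le> S m" "\<bar>e m\<bar> \<le> 3 * S m" using Suc by (auto simp: m_def)
    have r: "(3 + 2*l) * e (Suc m) - 4 * e m + e n = h (Suc m)"
      using rec[of "Suc m"] Suc.prems by (simp add: m_def)
    have "e (Suc m) = (h (Suc m) + 4 * e m - e n) / (3 + 2*l)"
      using l r by (simp add: field_simps)
    also have "\<dots> = h (Suc m) / (3 + 2*l) + (4 / (3 + 2*l)) * e m - (1 / (3 + 2*l)) * e n"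
      by (simp add: add_divide_distrib diff_divide_distrib)
    also have "\<dots> = h (Suc m) / (3 + 2*l) + (r1 + r2) * e m - (r1 * r2) * e n"
      by (simp only: sumr prodr)
    finally have d: "e (Suc m) - r2 * e m = r1 * (e m - r2 * e n) + h (Suc m) / (3 + 2*l)"
      by (simp add: algebra_simps)
    have "\<bar>e (Suc m) - r2 * e m\<bar> \<le> r1 * \<bar>e m - r2 * e n\<bar> + \<bar>h (Suc m)\<bar> / (3 + 2*l)"
      unfolding d using r1 l by (intro order_trans[OF abs_triangle_ineq]) (simp add: abs_mult)
    also have "\<dots> \<le> \<rho> * S m + \<bar>h (Suc m)\<bar>"
    proof (intro add_mono mult_mono)
      have "\<bar>h (Suc m)\<bar> * 1 \<le> \<bar>h (Suc m)\<bar> * (3 + 2*l)" using l by (intro mult_left_mono) auto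
      then show "\<bar>h (Suc m)\<bar> / (3 + 2*l) \<le> \<bar>h (Suc m)\<bar>" using l by (simp add: divide_simps)
    qed (use r1 IH \<rho> S_nonneg in auto)
    finally have D: "\<bar>e (Suc m) - r2 * e m\<bar> \<le> S (Suc m)" by (simp add: S_Suc)
    have "\<bar>e (Suc m)\<bar> \<le> r2 * \<bar>e m\<bar> + S (Suc m)"
      using D r2 abs_triangle_ineq[of "e (Suc m) - r2 * e m" "r2 * e m"] by (simp add: abs_mult)
    also have "r2 * \<bar>e m\<bar> \<le> (1/2) * (3 * S m)"
      using r2 IH by (intro mult_mono) auto
    \<comment> \<open>As \<rho> is at least 3/4, \<open>S m\<close> is at most 4/3 of
      \<open>S (Suc m)\<close>. The constant 3 therefore reproduces itself: 1 + (1/2) * 3 * (4/3) =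
      3.\<close>
    also have "(1/2) * (3 * S m) \<le> 2 * S (Suc m)"
      using mult_right_mono[OF \<rho> S_nonneg[of m]] by (simp add: S_Suc)
    finally show ?case using D by (simp add: m_def)
  qed
  show ?thesis using *[of "n - 1"] n by (simp add: S_def \<rho>_def)
qed

section \<open>Summation of the damped weights\<close>

lemma sum_inverse_squares_le: "(\<Sum>j=1..n. 1 / (real j)^2) \<le> 2"
proof -
  \<comment> \<open>The sharper bound makes the induction telescope, an inverse square being at most
    a difference of consecutive reciprocals.\<close>
  have "(\<Sum>j=1..Suc n. 1 / (real j)^2) \<le> 2 - 1 / real (Suc n)" for n
  proof (induction n)
    case (Suc n)
    have "1 / real (Suc (Suc n))^2 \<le> 1 / (real (Suc n) * real (Suc (Suc n)))"
      unfolding power2_eq_square by (intro divide_left_mono mult_right_mono) auto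
    also have "\<dots> = 1 / real (Suc n) - 1 / real (Suc (Suc n))"
      by (simp add: field_simps)
    finally show ?case using Suc.IH by simp
  qed simp
  from this[of "n - 1"] show ?thesis
    by (cases n) (auto intro: order_trans)
qed

text \<open>
  Terms with \<open>2 * j \<le> n\<close> are damped by at least \<open>exp (-l * n / 2)\<close> and their weights
  are summable; in the others the weight is itself of size \<open>n powr (\<alpha> - 3)\<close>.
\<close>

lemma damped_weight_sum_le:
  fixes l \<alpha> :: real
  assumes l: "0 \<le> l" and \<alpha>: "0 < \<alpha>" "\<alpha> < 1" and n: "1 \<le> n"
  shows "(\<Sum>j=1..n. exp (-l) ^ (n-j) * real j powr (\<alpha> - 3))
    \<le> 2 * exp (-l * real n / 2) + 8 * real n powr (\<alpha> - 2)"
proof -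
  define x where "x = exp (-l * real n / 2)"
  \<comment> \<open>Adding the bounds of both cases gives one estimate valid for every
    \<open>j\<close>, so the sum need not be split.\<close>
  have "exp (-l) ^ (n-j) * real j powr (\<alpha> - 3) \<le> x * (1 / (real j)^2) + 8 * real n powr (\<alpha> - 3)"
    if j: "j \<in> {1..n}" for j
  proof (cases "2 * j \<le> n")
    case True
    have "exp (-l) ^ (n-j) = exp (-l * real (n - j))"
      by (simp add: exp_of_nat_mult[symmetric] mult.commute)
    also have "\<dots> \<le> x"
    proof -
      have "real n / 2 \<le> real (n - j)" using True by (simp add: of_nat_diff)
      from mult_left_mono[OF this l] show ?thesis by (simp add: x_def)
    qed
    finally have "exp (-l) ^ (n-j) \<le> x" .
    moreover have "real j powr (\<alpha> - 3) \<le> real j powr (-2)"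
      using j \<alpha> by (intro powr_mono) auto
    moreover have "real j powr (-2) = 1 / (real j)^2"
      using j by (simp add: powr_minus powr_numeral divide_simps)
    ultimately have "exp (-l) ^ (n-j) * real j powr (\<alpha> - 3) \<le> x * (1 / (real j)^2)"
      by (intro mult_mono) (auto simp: x_def)
    then show ?thesis by (simp add: add_increasing2)
  next
    case False
    \<comment> \<open>Here \<open>j > n/2\<close> and the exponent is negative; replacing
      \<open>j\<close> by \<open>n\<close> costs \<open>2 powr (3 - \<alpha>)\<close>, at most
      8.\<close>
    have "real j powr (\<alpha> - 3) \<le> (real n / 2) powr (\<alpha> - 3)"
      using False n \<alpha> by (intro powr_mono2') auto
    also have "\<dots> = 2 powr (3 - \<alpha>) * real n powr (\<alpha> - 3)"
      by (simp add: powr_divide powr_diff field_simps)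
    also have "2 powr (3 - \<alpha>) \<le> 2 powr (3::real)" using \<alpha> by (intro powr_mono) auto
    finally have "real j powr (\<alpha> - 3) \<le> 8 * real n powr (\<alpha> - 3)"
      by (simp add: mult_right_mono powr_numeral)
    moreover have "exp (-l) ^ (n-j) \<le> 1" using l by (intro power_le_one) auto
    ultimately have "exp (-l) ^ (n-j) * real j powr (\<alpha> - 3) \<le> 1 * (8 * real n powr (\<alpha> - 3))"
      by (intro mult_mono) auto
    then show ?thesis by (simp add: x_def add_increasing)
  qed
  then have "(\<Sum>j=1..n. exp (-l) ^ (n-j) * real j powr (\<alpha> - 3))
      \<le> (\<Sum>j=1..n. x * (1 / (real j)^2) + 8 * real n powr (\<alpha> - 3))"
    by (rule sum_mono)
  also have "\<dots> = x * (\<Sum>j=1..n. 1 / (real j)^2) + 8 * (real n * real n powr (\<alpha> - 3))"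
    by (simp add: sum.distrib sum_distrib_left)
  also have "real n * real n powr (\<alpha> - 3) = real n powr (\<alpha> - 2)"
    using n powr_add[of "real n" 1 "\<alpha> - 3"] by simp
  also have "x * (\<Sum>j=1..n. 1 / (real j)^2) \<le> x * 2"
    by (intro mult_left_mono sum_inverse_squares_le) (simp add: x_def)
  finally show ?thesis by (simp add: x_def)
qed

section \<open>Consistency errors\<close>

lemma has_real_derivative_nth_deriv_within:
  assumes "times_cont_diff_on k u S" "j < k" "t \<in> S"
  shows "(nth_deriv_within j u S has_real_derivative nth_deriv_within (Suc j) u S t) (at t within S)"
  using assms
  by (auto simp: times_cont_diff_on_def differentiable_on_def vector_derivative_works
      has_real_derivative_iff_has_vector_derivative)

text \<open>The function \<open>M / \<alpha> * t powr \<alpha>\<close> is an antiderivative of the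
  bound on \<open>u'\<close>, so adding or subtracting \<open>u\<close> leaves it nondecreasing.
  Monotonicity needs derivatives only inside the interval and continuity at its ends, which admits
  the singular point \<open>a = 0\<close>.\<close>

lemma increment_le_powr:
  fixes u :: "real \<Rightarrow> real"
  assumes \<alpha>: "0 < \<alpha>" and ab: "0 \<le> a" "a < b"
    and cont: "continuous_on {a..b} u"
    and der: "\<And>t. a < t \<Longrightarrow> t < b \<Longrightarrow> (u has_real_derivative u' t) (at t)"
    and bound: "\<And>t. a < t \<Longrightarrow> t < b \<Longrightarrow> \<bar>u' t\<bar> \<le> M * t powr (\<alpha> - 1)"
  shows "\<bar>u b - u a\<bar> \<le> M / \<alpha> * (b powr \<alpha> - a powr \<alpha>)"
proof -
  have cp: "continuous_on {a..b} (\<lambda>t. M / \<alpha> * t powr \<alpha>)"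
    using ab \<alpha> by (intro continuous_intros continuous_on_powr') auto
  have dp: "((\<lambda>t. M / \<alpha> * t powr \<alpha>) has_real_derivative M * t powr (\<alpha> - 1)) (at t)"
    if "a < t" for t
    using that ab \<alpha> by (auto intro!: derivative_eq_intros)
  have "M / \<alpha> * a powr \<alpha> - u a \<le> M / \<alpha> * b powr \<alpha> - u b"
  proof (rule DERIV_nonneg_imp_increasing_open[where a = a and b = b
        and f = "\<lambda>t. M / \<alpha> * t powr \<alpha> - u t"])
    fix t assume "a < t" "t < b"
    then show "\<exists>y. ((\<lambda>t. M / \<alpha> * t powr \<alpha> - u t) has_real_derivative y) (at t) \<and> 0 \<le> y"
      using DERIV_diff[OF dp der, of t] bound[of t] by fastforce
  qed (use ab cp cont in \<open>auto intro: continuous_on_diff\<close>)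
  moreover have "M / \<alpha> * a powr \<alpha> + u a \<le> M / \<alpha> * b powr \<alpha> + u b"
  proof (rule DERIV_nonneg_imp_increasing_open[where a = a and b = b
        and f = "\<lambda>t. M / \<alpha> * t powr \<alpha> + u t"])
    fix t assume "a < t" "t < b"
    then show "\<exists>y. ((\<lambda>t. M / \<alpha> * t powr \<alpha> + u t) has_real_derivative y) (at t) \<and> 0 \<le> y"
      using DERIV_add[OF dp der, of t] bound[of t] by fastforce
  qed (use ab cp cont in \<open>auto intro: continuous_on_add\<close>)
  ultimately show ?thesis by (simp add: algebra_simps)
qed

lemma ivp_solution_increment_le:
  assumes \<alpha>: "0 < \<alpha>" and M: "0 \<le> M"
    and sol: "ivp_solution \<kappa> f u0 T u" and reg: "regularity_bound \<alpha> M T u"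
    and ab: "0 \<le> a" "a < b" "b \<le> T"
  shows "\<bar>u b - u a\<bar> \<le> M / \<alpha> * b powr \<alpha>"
proof -
  let ?S = "{0<..T}"
  have cont: "continuous_on {a..b} u"
    using sol ab by (auto simp: ivp_solution_def intro: continuous_on_subset)
  have smooth: "times_cont_diff_on 3 u ?S" using sol by (simp add: ivp_solution_def)
  have der: "(u has_real_derivative nth_deriv_within 1 u ?S t) (at t)" if "a < t" "t < b" for t
  proof -
    \<comment> \<open>At interior points the relative derivative is the two-sided one; this also
      allows \<open>b = T\<close>.\<close>
    have "t \<in> interior ?S"
      using that ab by (intro interiorI[of "{0<..<T}"]) auto
    moreover have "(u has_real_derivative nth_deriv_within 1 u ?S t) (at t within ?S)"
      using has_real_derivative_nth_deriv_within[OF smooth, of 0 t] that ab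
      by (simp del: nth_deriv_within.simps(2))
    ultimately show ?thesis by (simp only: at_within_interior)
  qed
  have "\<bar>u b - u a\<bar> \<le> M / \<alpha> * (b powr \<alpha> - a powr \<alpha>)"
  proof (rule increment_le_powr[OF \<alpha> ab(1,2) cont der])
    show "\<bar>nth_deriv_within 1 u ?S t\<bar> \<le> M * t powr (\<alpha> - 1)" if "a < t" "t < b" for t
      using reg[unfolded regularity_bound_def, rule_format, of 1 t] that ab by simp
  qed
  also have "\<dots> \<le> M / \<alpha> * b powr \<alpha>"
    using \<alpha> M by (intro mult_left_mono) auto
  finally show ?thesis .
qed

text \<open>Second-order expansion about \<open>t\<close> cancels every term up to
  \<open>u''\<close> in the BDF2 difference. The third derivative is controlled on the whole stencil
  by its bound at the left end \<open>t - 2*\<tau>\<close>, positive by assumption.\<close>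

lemma bdf2_taylor_defect_le:
  assumes \<alpha>: "\<alpha> < 1"
    and sol: "ivp_solution \<kappa> f u0 T u" and reg: "regularity_bound \<alpha> M T u"
    and ab: "0 < \<tau>" "2 * \<tau> < t" "t \<le> T"
  shows "\<bar>3 * u t - 4 * u (t - \<tau>) + u (t - 2*\<tau>) - 2 * \<tau> * nth_deriv_within 1 u {0<..T} t\<bar>
    \<le> 6 * M * (t - 2*\<tau>) powr (\<alpha> - 3) * \<tau>^3"
proof -
  let ?D = "\<lambda>k. nth_deriv_within k u {0<..T}"
  let ?S = "{t - 2*\<tau>..t}"
  define B where "B = M * (t - 2*\<tau>) powr (\<alpha> - 3)"
  have sub: "?S \<subseteq> {0<..T}" using ab by auto
  have "0 \<le> \<bar>?D 3 t\<bar>" by simp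
  also have "\<bar>?D 3 t\<bar> \<le> M * t powr (\<alpha> - 3)"
    using reg[unfolded regularity_bound_def, rule_format, of 3 t] ab by simp
  finally have M: "0 \<le> M" using ab by (simp add: zero_le_mult_iff)
  have bound: "norm (?D (Suc 2) x) \<le> B" if "x \<in> ?S" for x
  proof -
    have "norm (?D (Suc 2) x) \<le> M * x powr (\<alpha> - 3)"
      using reg[unfolded regularity_bound_def, rule_format, of 3 x] sub that
      by (auto simp: numeral_3_eq_3 numeral_2_eq_2 simp del: nth_deriv_within.simps)
    also have "\<dots> \<le> B"
      using that ab \<alpha> M by (auto simp: B_def intro!: mult_left_mono powr_mono2')
    finally show ?thesis .
  qed
  have smooth: "times_cont_diff_on 3 u {0<..T}" using sol by (simp add: ivp_solution_def)
  have der: "(?D i has_real_derivative ?D (Suc i) x) (at x within ?S)" if "x \<in> ?S" "i \<le> 2" for i x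
    using that sub
    by (intro has_field_derivative_subset[OF has_real_derivative_nth_deriv_within[OF smooth] sub])
      auto
  \<comment> \<open>This form of Taylor's theorem has 2! rather than 3! in the remainder, giving
    \<open>F / 2\<close> at distance \<tau> and \<open>4 * F\<close> at distance
    \<open>2*\<tau>\<close>. The total is 4 * (1/2) + 4 = 6 times \<open>F\<close>.\<close>
  have "norm (?D 0 z - (\<Sum>i\<le>2. ?D i t * (z - t) ^ i / fact i)) \<le> B * norm (z - t) ^ Suc 2 / fact 2"
    if "z \<in> ?S" for z
    using that ab by (intro field_Taylor[where S = ?S and f = ?D] der bound) auto
  then have taylor: "\<bar>u z - (u t + ?D 1 t * (z - t) + ?D 2 t * (z - t)^2 / 2)\<bar> \<le> B * \<bar>z - t\<bar>^3 / 2"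
    if "z \<in> ?S" for z
    using that
    by (simp add: atMost_nat_numeral numeral_3_eq_3 add_ac fact_numeral del: nth_deriv_within.simps(2))
  define A where "A = \<tau> * ?D 1 t"
  define E where "E = \<tau>^2 * ?D 2 t"
  define F where "F = B * \<tau>^3"
  have "\<bar>u (t - \<tau>) - (u t - A + E / 2)\<bar> \<le> F / 2"
    using taylor[of "t - \<tau>"] ab
    by (simp add: A_def E_def F_def mult_ac del: nth_deriv_within.simps(2))
  moreover have "\<bar>u (t - 2*\<tau>) - (u t - 2 * A + 2 * E)\<bar> \<le> 4 * F"
    using taylor[of "t - 2*\<tau>"] ab
    by (simp add: A_def E_def F_def power_mult_distrib abs_mult mult_ac del: nth_deriv_within.simps(2))
  ultimately have "\<bar>3 * u t - 4 * u (t - \<tau>) + u (t - 2*\<tau>) - 2 * A\<bar> \<le> 6 * F" by linarith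
  then show ?thesis by (simp add: A_def F_def B_def mult_ac del: nth_deriv_within.simps(2))
qed

text \<open>The consistency error is scaled by \<tau> in the Euler step and by
  \<open>2 * \<tau>\<close> afterwards, making it exactly the right-hand side of the error
  recurrence in \<open>bdf2_stability\<close>.\<close>

definition bdf2_defect :: "(real \<Rightarrow> real) \<Rightarrow> (real \<Rightarrow> real) \<Rightarrow> real \<Rightarrow> nat \<Rightarrow> real" where
  "bdf2_defect u u' \<tau> n =
    (if n = 1 then u \<tau> - u 0 - \<tau> * u' \<tau>
     else 3 * u (real n * \<tau>) - 4 * u (real (n-1) * \<tau>) + u (real (n-2) * \<tau>)
       - 2 * \<tau> * u' (real n * \<tau>))"

text \<open>
  The first two steps touch the singularity at \<open>0\<close> and are estimated through increments
  of \<open>u\<close>, the others by Taylor expansion about \<open>n * \<tau>\<close>.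
\<close>

lemma bdf2_defect_le:
  assumes \<alpha>: "0 < \<alpha>" "\<alpha> < 1"
    and sol: "ivp_solution \<kappa> f u0 T u" and reg: "regularity_bound \<alpha> M T u"
    and \<tau>: "0 < \<tau>" and n: "1 \<le> n" "real n * \<tau> \<le> T"
  shows "\<bar>bdf2_defect u (nth_deriv_within 1 u {0<..T}) \<tau> n\<bar>
    \<le> 162 * M / \<alpha> * real n powr (\<alpha> - 3) * \<tau> powr \<alpha>"
proof -
  let ?u' = "nth_deriv_within 1 u {0<..T}"
  define p where "p = \<tau> powr \<alpha>"
  have p: "p \<ge> 0" by (simp add: p_def)
  have "\<tau> \<le> real n * \<tau>" using n \<tau> by simp
  then have T: "\<tau> \<le> T" using n by linarith
  have d1: "\<bar>?u' t\<bar> \<le> M * t powr (\<alpha> - 1)" if "0 < t" "t \<le> T" for t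
    using reg[unfolded regularity_bound_def, rule_format, of 1 t] that by simp
  have "0 \<le> M * \<tau> powr (\<alpha> - 1)" using d1[OF \<tau> T] by linarith
  then have M: "0 \<le> M" using \<tau> by (simp add: zero_le_mult_iff)
  have Mle: "M \<le> M / \<alpha>" using M \<alpha> by (simp add: divide_simps mult_left_le)
  have td: "t * \<bar>?u' t\<bar> \<le> M / \<alpha> * t powr \<alpha>" if "0 < t" "t \<le> T" for t
  proof -
    have "t * \<bar>?u' t\<bar> \<le> t * (M * t powr (\<alpha> - 1))"
      using that d1 by (intro mult_left_mono) auto
    also have "\<dots> = M * t powr \<alpha>"
      using that powr_add[of t 1 "\<alpha> - 1"] by simp
    also have "\<dots> \<le> M / \<alpha> * t powr \<alpha>" using Mle by (intro mult_right_mono) auto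
    finally show ?thesis .
  qed
  note inc = ivp_solution_increment_le[OF \<alpha>(1) M sol reg]
  define q where "q = M / \<alpha> * p"
  have q: "q \<ge> 0" using M \<alpha> p by (simp add: q_def)
  consider "n = 1" | "n = 2" | "n \<ge> 3" using n by linarith
  then show ?thesis
  proof cases
    case 1
    have "\<bar>u \<tau> - u 0\<bar> \<le> q" using inc[of 0 \<tau>] \<tau> T by (simp add: q_def p_def)
    moreover have "\<bar>\<tau> * ?u' \<tau>\<bar> \<le> q" using td[of \<tau>] \<tau> T by (simp add: q_def p_def abs_mult)
    ultimately have "\<bar>u \<tau> - u 0 - \<tau> * ?u' \<tau>\<bar> \<le> 162 * q" using q by linarith
    then show ?thesis using 1 by (simp add: bdf2_defect_def q_def p_def)
  next
    case 2
    have T2: "2 * \<tau> \<le> T" using n 2 by simp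
    have "(2 * \<tau>) powr \<alpha> \<le> 2 * p"
    proof -
      have "2 powr \<alpha> \<le> 2 powr (1::real)" using \<alpha> by (intro powr_mono) auto
      then show ?thesis using \<tau> by (simp add: powr_mult p_def mult_right_mono)
    qed
    then have le: "M / \<alpha> * (2 * \<tau>) powr \<alpha> \<le> 2 * q"
      using mult_left_mono[of "(2 * \<tau>) powr \<alpha>" "2 * p" "M / \<alpha>"] M \<alpha> by (simp add: q_def mult_ac)
    have "\<bar>u \<tau> - u 0\<bar> \<le> q" using inc[of 0 \<tau>] \<tau> T by (simp add: q_def p_def)
    moreover have "\<bar>u (2*\<tau>) - u \<tau>\<bar> \<le> 2 * q" using inc[of \<tau> "2*\<tau>"] \<tau> T2 le by simp
    moreover have "\<bar>2 * \<tau> * ?u' (2*\<tau>)\<bar> \<le> 2 * q"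
      using td[of "2*\<tau>"] \<tau> T2 le by (simp add: abs_mult)
    \<comment> \<open>The difference is 3 * (\<open>u (2*\<tau>) - u \<tau>\<close>) minus
      (\<open>u \<tau> - u 0\<close>), so 9 = 3 * 2 + 1 + 2.\<close>
    ultimately have "\<bar>bdf2_defect u ?u' \<tau> n\<bar> \<le> 9 * q"
      using 2 by (simp add: bdf2_defect_def del: nth_deriv_within.simps)
    also have "\<dots> \<le> 162 * q * (1 / 8)" using q by simp
    also have "\<dots> \<le> 162 * q * real n powr (\<alpha> - 3)"
    proof (rule mult_left_mono)
      have "2 powr (-3) \<le> (2::real) powr (\<alpha> - 3)" using \<alpha> by (intro powr_mono) auto
      then show "1 / 8 \<le> real n powr (\<alpha> - 3)" using 2 by (simp add: powr_minus powr_numeral)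
    qed (use q in simp)
    finally show ?thesis by (simp add: q_def p_def mult_ac)
  next
    case 3
    define s where "s = real n * \<tau>"
    have "2 * \<tau> < s" using 3 \<tau> by (simp add: s_def)
    then have "\<bar>bdf2_defect u ?u' \<tau> n\<bar> \<le> 6 * M * (s - 2*\<tau>) powr (\<alpha> - 3) * \<tau>^3"
      using bdf2_taylor_defect_le[OF \<alpha>(2) sol reg \<tau>, of s] n 3
      by (simp add: bdf2_defect_def s_def of_nat_diff algebra_simps del: nth_deriv_within.simps)
    \<comment> \<open>For \<open>n \<ge> 3\<close> the left end of the stencil is at least
      \<open>s / 3\<close>. Moving the weight to \<open>s\<close> costs at most 27, hence 162 = 6 *
      27.\<close>
    also have "(s - 2*\<tau>) powr (\<alpha> - 3) \<le> (s / 3) powr (\<alpha> - 3)"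
    proof (rule powr_mono2')
      have "3 * \<tau> \<le> real n * \<tau>" using 3 \<tau> by simp
      then show "s / 3 \<le> s - 2*\<tau>" unfolding s_def by linarith
    qed (use \<alpha> 3 \<tau> in \<open>auto simp: s_def\<close>)
    also have "(s / 3) powr (\<alpha> - 3) = 3 powr (3 - \<alpha>) * s powr (\<alpha> - 3)"
      using \<tau> by (simp add: s_def powr_divide powr_diff field_simps)
    also have "3 powr (3 - \<alpha>) \<le> 3 powr (3::real)" using \<alpha> by (intro powr_mono) auto
    also have "3 powr (3::real) = (27::real)" by simp
    also have "6 * M * (27 * s powr (\<alpha> - 3)) * \<tau>^3
        = 162 * M * (real n powr (\<alpha> - 3) * (\<tau> powr (\<alpha> - 3) * \<tau> powr 3))"
      using \<tau> by (simp add: s_def powr_mult)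
    also have "\<tau> powr (\<alpha> - 3) * \<tau> powr 3 = p" by (simp add: p_def powr_add[symmetric])
    also have "162 * M * (real n powr (\<alpha> - 3) * p) \<le> 162 * (M / \<alpha>) * (real n powr (\<alpha> - 3) * p)"
      using Mle p by (intro mult_right_mono) auto
    finally show ?thesis
      using M \<tau> by (simp add: p_def mult_ac mult_right_mono mult_left_mono)
  qed
qed

section \<open>The constants \<open>C5\<close>, \<open>C6\<close> and the error bound\<close>

text \<open>
  \<open>C6\<close> vanishes at small times, but there \<open>exp (\<kappa> * t / 2)\<close> is bounded below, so the
  first term absorbs the second.
\<close>

lemma C5_C6_lower_bound:
  assumes \<alpha>: "0 < \<alpha>" "\<alpha> < 1" and \<kappa>: "\<kappa> < 0" and s: "0 \<le> s" "s \<le> p"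
  shows "exp (\<kappa> * t / 2) * p + s
    \<le> 4 * (C5 \<alpha> \<kappa> t * exp (\<kappa> * t / 2) * p + C6 \<alpha> \<kappa> t * s)"
proof -
  define x where "x = exp (\<kappa> * t / 2)"
  define q :: real where "q = 2 powr (2 - \<alpha>)"
  define R where "R = C5 \<alpha> \<kappa> t * x * p + C6 \<alpha> \<kappa> t * s"
  have x: "0 < x" by (simp add: x_def)
  have "2 powr (1::real) \<le> q" unfolding q_def using \<alpha> by (intro powr_mono) auto
  then have q: "q \<ge> 2" by simp
  have iq: "2 powr (\<alpha> - 2) = 1 / q" by (simp add: q_def powr_diff)
  have "1 / q \<le> 1 / 2" using q by (simp add: divide_simps)
  have C5: "C5 \<alpha> \<kappa> t \<ge> 1"
  proof -
    have "1 \<le> 2 / (2 - \<alpha>)" using \<alpha> by simp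
    then show ?thesis by (simp add: C5_def add_increasing2)
  qed
  have key: "1 / 4 \<le> x / 2 + C6 \<alpha> \<kappa> t"
  proof (cases "t > 2 / \<kappa> * ln (1 - 2 powr (\<alpha> - 2))")
    case True
    \<comment> \<open>Since \<kappa> is negative, the threshold for \<open>t\<close> says
      \<open>x < 1 - 1/q\<close>, which is exactly where the nontrivial expression in
      \<open>C6\<close> is positive.\<close>
    have "\<kappa> * t / 2 < ln (1 - 1 / q)" using True \<kappa> by (simp add: iq field_simps)
    then have "x < exp (ln (1 - 1 / q))" unfolding x_def by (simp only: exp_less_cancel_iff)
    also have "\<dots> = 1 - 1 / q" using \<open>1 / q \<le> 1 / 2\<close> by simp
    finally have x1: "1 / q < 1 - x" by simp
    then have y: "1 < q * (1 - x)" using q by (simp add: field_simps)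
    have "1 / 2 * (q * (1 - x) - 1) \<le> 1 / (2 - \<alpha>) * (q * (1 - x) - 1)"
      using y \<alpha> by (intro mult_right_mono) (auto simp: divide_simps)
    then have "C6 \<alpha> \<kappa> t \<ge> 1 / 2 * (q * (1 - x) - 1)"
      using True by (simp add: C6_def x_def q_def)
    moreover have "x + (q * (1 - x) - 1) = (q - 1) * (1 - x)" by (simp add: algebra_simps)
    \<comment> \<open>As \<open>q \<ge> 2\<close>, \<open>q - 1\<close> is at least
      \<open>q / 2\<close>; with \<open>q * (1 - x) > 1\<close> this puts
      \<open>x + 2 * C6 \<alpha> \<kappa> t\<close> above 1/2.\<close>
    moreover have "(q / 2) * (1 - x) \<le> (q - 1) * (1 - x)"
    proof (rule mult_right_mono)
      show "0 \<le> 1 - x" using x1 q by (smt (verit) divide_nonneg_nonneg)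
    qed (use q in simp)
    ultimately show ?thesis using y by simp
  next
    case False
    have "\<kappa> * t / 2 \<ge> ln (1 - 1 / q)" using False \<kappa> by (simp add: iq field_simps)
    then have "x \<ge> exp (ln (1 - 1 / q))" unfolding x_def by (simp only: exp_le_cancel_iff)
    moreover have "exp (ln (1 - 1 / q)) = 1 - 1 / q" using \<open>1 / q \<le> 1 / 2\<close> by simp
    ultimately show ?thesis using False \<open>1 / q \<le> 1 / 2\<close> by (simp add: C6_def)
  qed
  \<comment> \<open>Half of \<open>x * p\<close> is kept; the other half pays for
    \<open>x * s / 2\<close>, because \<open>s \<le> p\<close>.\<close>
  have "x * p / 2 + s / 4 \<le> x * p / 2 + (x / 2 + C6 \<alpha> \<kappa> t) * s"
    using mult_right_mono[OF key s(1)] by simp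
  also have "\<dots> \<le> x * p + C6 \<alpha> \<kappa> t * s"
  proof -
    have "x * s \<le> x * p" using x s by simp
    then show ?thesis by (simp add: algebra_simps)
  qed
  also have "x * p \<le> C5 \<alpha> \<kappa> t * (x * p)"
    using C5 x s mult_right_mono[of 1 "C5 \<alpha> \<kappa> t" "x * p"] by simp
  also have "C5 \<alpha> \<kappa> t * (x * p) + C6 \<alpha> \<kappa> t * s = R" by (simp add: R_def)
  finally have "x * p / 2 + s / 4 \<le> R" by simp
  moreover have "0 \<le> x * p" using x s by simp
  ultimately show ?thesis unfolding x_def[symmetric] R_def[symmetric] by linarith
qed

text \<open>The differential equation turns \<kappa>u + f into u', so the error satisfies the
  recurrence of \<open>bdf2_stability\<close> with the defects as data. The constant is 486 = 3 *
  162, from stability and consistency.\<close>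

lemma bdf2_error_le:
  fixes u f :: "real \<Rightarrow> real" and U :: "nat \<Rightarrow> real"
  assumes \<alpha>: "0 < \<alpha>" "\<alpha> < 1" and \<kappa>: "\<kappa> < 0" and \<tau>: "0 < \<tau>" "- 4 * \<kappa> * \<tau> < 1"
    and sol: "ivp_solution \<kappa> f u0 T u" and reg: "regularity_bound \<alpha> M T u"
    and U: "bdf2_scheme \<kappa> f u0 \<tau> N U" and N: "real N * \<tau> \<le> T" and n: "1 \<le> n" "n \<le> N"
  shows "\<bar>u (real n * \<tau>) - U n\<bar>
    \<le> 486 * M / \<alpha> * \<tau> powr \<alpha> * (2 * exp (\<kappa> * (real n * \<tau>) / 2) + 8 * real n powr (\<alpha> - 2))"
proof -
  let ?u' = "nth_deriv_within 1 u {0<..T}"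
  define l where "l = - \<kappa> * \<tau>"
  define e where "e n = u (real n * \<tau>) - U n" for n
  define h where "h = bdf2_defect u ?u' \<tau>"
  define G where "G = 162 * M / \<alpha> * \<tau> powr \<alpha>"
  have l: "0 < l" "l < 1/4" using \<kappa> \<tau> by (auto simp: l_def mult_neg_pos)
  have le: "real j * \<tau> \<le> T" if "j \<le> N" for j
  proof -
    have "real j * \<tau> \<le> real N * \<tau>" using that \<tau> by simp
    then show ?thesis using N by linarith
  qed
  have ode: "?u' (real j * \<tau>) = \<kappa> * u (real j * \<tau>) + f (real j * \<tau>)" if "1 \<le> j" "j \<le> N" for j
    using sol that \<tau> le[of j] by (auto simp: ivp_solution_def simp del: nth_deriv_within.simps)
  have e0: "e 0 = 0" using sol U by (simp add: e_def ivp_solution_def bdf2_scheme_def)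
  have e1: "(1 + l) * e 1 = h 1"
  proof -
    have "U 1 - U 0 = \<tau> * (\<kappa> * U 1 + f \<tau>)" using U \<tau> by (simp add: bdf2_scheme_def field_simps)
    moreover have "U 0 = u 0" using e0 by (simp add: e_def)
    moreover have "?u' \<tau> = \<kappa> * u \<tau> + f \<tau>" using ode[of 1] n by simp
    ultimately show ?thesis by (simp add: h_def bdf2_defect_def e_def l_def algebra_simps)
  qed
  have rec: "(3 + 2*l) * e j - 4 * e (j-1) + e (j-2) = h j" if "2 \<le> j" "j \<le> N" for j
  proof -
    have "(3 * U j - 4 * U (j-1) + U (j-2)) / (2 * \<tau>) = \<kappa> * U j + f (real j * \<tau>)"
      using U that by (simp add: bdf2_scheme_def)
    then have "3 * U j - 4 * U (j-1) + U (j-2) = 2 * \<tau> * (\<kappa> * U j + f (real j * \<tau>))"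
      using \<tau> by (simp add: field_simps)
    moreover have "h j = 3 * u (real j * \<tau>) - 4 * u (real (j-1) * \<tau>) + u (real (j-2) * \<tau>)
        - 2 * \<tau> * (\<kappa> * u (real j * \<tau>) + f (real j * \<tau>))"
      using that ode[of j] by (simp add: h_def bdf2_defect_def del: nth_deriv_within.simps)
    ultimately show ?thesis by (simp add: e_def l_def algebra_simps)
  qed
  have h: "\<bar>h j\<bar> \<le> G * real j powr (\<alpha> - 3)" if "1 \<le> j" "j \<le> N" for j
    using bdf2_defect_le[OF \<alpha> sol reg \<tau>(1) that(1) le[OF that(2)]] by (simp add: h_def G_def mult_ac)
  have "0 \<le> G" using h[of 1] n by simp
  have "\<bar>e n\<bar> \<le> 3 * (\<Sum>j=1..n. exp (-l) ^ (n-j) * \<bar>h j\<bar>)"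
    by (rule bdf2_stability[OF l e0 e1 rec n])
  also have "\<dots> \<le> 3 * (\<Sum>j=1..n. exp (-l) ^ (n-j) * (G * real j powr (\<alpha> - 3)))"
    using n h by (intro mult_left_mono sum_mono) auto
  also have "\<dots> = 3 * G * (\<Sum>j=1..n. exp (-l) ^ (n-j) * real j powr (\<alpha> - 3))"
    by (simp add: sum_distrib_left mult_ac)
  also have "\<dots> \<le> 3 * G * (2 * exp (-l * real n / 2) + 8 * real n powr (\<alpha> - 2))"
    using l \<alpha> n \<open>0 \<le> G\<close> by (intro mult_left_mono damped_weight_sum_le) auto
  finally show ?thesis by (simp add: e_def G_def l_def mult_ac)
qed

theorem theorem2p3:
  fixes \<alpha> M :: real
  assumes "0 < \<alpha>" and "\<alpha> < 1"
  shows "\<exists>C>0. \<forall>(\<kappa>::real) (T::real) (N::nat) (u0::real) (f::real \<Rightarrow> real) (u::real \<Rightarrow> real) (U::nat \<Rightarrow> real).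
    let \<tau> = T / real N;
        t = (\<lambda>n. real n * \<tau>);
        e = (\<lambda>n. u (t n) - U n)
    in \<kappa> < 0 \<longrightarrow> T > 0 \<longrightarrow> N \<ge> 2 \<longrightarrow>
       ivp_solution \<kappa> f u0 T u \<longrightarrow>
       regularity_bound \<alpha> M T u \<longrightarrow>
       bdf2_scheme \<kappa> f u0 \<tau> N U \<longrightarrow>
       0 < - 4 * \<kappa> * \<tau> \<longrightarrow> - 4 * \<kappa> * \<tau> < 1 \<longrightarrow>
       (\<forall>n\<in>{2..N}.
          \<bar>e n\<bar> \<le> exp (\<kappa> * t n / 2) * \<bar>e 0\<bar>
            + 2 * C * (C5 \<alpha> \<kappa> (t n) * exp (\<kappa> * t n / 2) * \<tau> powr \<alpha>
                       + C6 \<alpha> \<kappa> (t n) * t (n - 1) powr (\<alpha> - 2) * \<tau>\<^sup>2))"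
proof -
  \<comment> \<open>The absolute value keeps \<open>K\<close> nonnegative for every real
    \<open>M\<close>, before any solution is given; the summand 1 in \<open>16 * K + 1\<close> keeps
    the final constant positive when \<open>M = 0\<close>.\<close>
  define K where "K = 486 * \<bar>M\<bar> / \<alpha>"
  have K: "0 \<le> K" using assms by (simp add: K_def)
  have main: "\<bar>u (real n * \<tau>) - U n\<bar> \<le> exp (\<kappa> * (real n * \<tau>) / 2) * \<bar>u (real 0 * \<tau>) - U 0\<bar>
      + 2 * (16 * K + 1) * (C5 \<alpha> \<kappa> (real n * \<tau>) * exp (\<kappa> * (real n * \<tau>) / 2) * \<tau> powr \<alpha>
        + C6 \<alpha> \<kappa> (real n * \<tau>) * (real (n - 1) * \<tau>) powr (\<alpha> - 2) * \<tau>\<^sup>2)"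
    (is "_ \<le> _ + 2 * (16 * K + 1) * ?R")
    if \<kappa>: "\<kappa> < 0" and T: "T > 0" and N: "N \<ge> 2"
      and sol: "ivp_solution \<kappa> f u0 T u" and reg: "regularity_bound \<alpha> M T u"
      and \<tau>_def: "\<tau> = T / real N" and U: "bdf2_scheme \<kappa> f u0 \<tau> N U"
      and \<tau>1: "- 4 * \<kappa> * \<tau> < 1" and n: "n \<in> {2..N}"
    for \<kappa> T N u0 f u U \<tau> n
  proof -
    define x where "x = exp (\<kappa> * (real n * \<tau>) / 2)"
    define p where "p = \<tau> powr \<alpha>"
    define s where "s = (real (n - 1) * \<tau>) powr (\<alpha> - 2) * \<tau>\<^sup>2"
    have \<tau>: "0 < \<tau>" "real N * \<tau> \<le> T" using T N by (auto simp: \<tau>_def)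
    have s_eq: "s = real (n - 1) powr (\<alpha> - 2) * p"
    proof -
      have "\<tau> powr (\<alpha> - 2) * \<tau> powr 2 = p" by (simp add: p_def powr_add[symmetric])
      then show ?thesis using \<tau> by (simp add: s_def powr_mult)
    qed
    \<comment> \<open>Here \<open>n \<ge> 2\<close> matters: \<open>n - 1\<close> is at least 1,
      which yields the \<open>s \<le> p\<close> required by
      \<open>C5_C6_lower_bound\<close>.\<close>
    have "real (n - 1) powr (\<alpha> - 2) \<le> 1 powr (\<alpha> - 2)"
      using n assms by (intro powr_mono2') auto
    then have s: "0 \<le> s" "s \<le> p" by (auto simp: s_eq p_def intro: mult_left_le_one_le)
    have "\<bar>u (real n * \<tau>) - U n\<bar> \<le> 486 * M / \<alpha> * p * (2 * x + 8 * real n powr (\<alpha> - 2))"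
      using bdf2_error_le[OF assms \<kappa> \<tau>(1) \<tau>1 sol reg U \<tau>(2), of n] n by (simp add: p_def x_def)
    \<comment> \<open>The weight is passed from \<open>n\<close> to \<open>n - 1\<close> to match
      the grid point in the claim, and 2 is raised to 8 for a common factor.\<close>
    also have "\<dots> \<le> K * p * (8 * x + 8 * real (n - 1) powr (\<alpha> - 2))"
    proof (intro mult_mono add_mono)
      show "486 * M / \<alpha> \<le> K" using assms by (simp add: K_def divide_right_mono)
      show "real n powr (\<alpha> - 2) \<le> real (n - 1) powr (\<alpha> - 2)"
        using n assms by (intro powr_mono2') auto
    qed (use K in \<open>auto simp: p_def x_def\<close>)
    also have "\<dots> = 8 * K * (x * p + s)" by (simp add: s_eq algebra_simps)
    \<comment> \<open>The product 8 * 4 = 32 is twice the 16 in the chosen constant, whose factor 2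
      stands in the claim.\<close>
    also have "\<dots> \<le> 8 * K * (4 * ?R)"
      using C5_C6_lower_bound[OF assms \<kappa> s, of "real n * \<tau>"] K
      by (intro mult_left_mono) (auto simp: x_def p_def s_def mult_ac)
    also have "\<dots> \<le> 2 * (16 * K + 1) * ?R"
    proof -
      have "0 \<le> x * p + s" using s by (simp add: x_def p_def)
      also have "\<dots> \<le> 4 * ?R"
        using C5_C6_lower_bound[OF assms \<kappa> s, of "real n * \<tau>"]
        by (simp add: x_def p_def s_def mult_ac)
      finally show ?thesis by (simp add: algebra_simps)
    qed
    finally show ?thesis by (simp add: add_increasing)
  qed
  show ?thesis
    unfolding Let_def
    by (rule exI[of _ "16 * K + 1"]) (use K main in \<open>auto simp del: of_nat_0\<close>)
qed

end
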